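(* Let $a<b$ be real numbers and let $f:[a,b]\to\mathbb{R}$ be convex on $[a,b]$. Then for every integer $n\ge1$, $$\text{(I)}\qquad \frac{1}{n(n+2)}\left[S_{n+1}-(b-a)f(a)\right]\le S_n-S_{n+1}\le\frac{1}{n^2}\left[(b-a)f(b)-S_{n+1}\right]$$ and $$\text{(II)}\qquad \frac{1}{n^2}\left[T_{n+1}-(b-a)f(a)\right]\le T_{n+1}-T_n\le\frac{1}{n(n+2)}\left[(b-a)f(b)-T_{n+1}\right].$$ Moreover, except for the case $n=1$, in which equality always holds in the right-hand inequality of (I) and in the left-hand inequality of (II), all inequalities are strict if $f$ is strictly convex. If $f$ is concave instead of convex, all inequalities in (I) and (II) are reversed.
   Context: For $n\ge1$ and $i=0,1,\ldots,n$ put $x_i^{(n)}=a+i\frac{b-a}{n}$, and define $S_n=\frac{b-a}{n}\sum_{i=1}^{n}f\bigl(x_i^{(n)}\bigr)$ and $T_n=\frac{b-a}{n}\sum_{i=0}^{n-1}f\bigl(x_i^{(n)}\bigr)$. *)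

theory Defs
  imports "HOL-Analysis.Analysis"
begin

definition grid_point :: "real \<Rightarrow> real \<Rightarrow> nat \<Rightarrow> nat \<Rightarrow> real"
  where "grid_point a b n i = a + real i * ((b - a) / real n)"

(* right_sum is S_n and left_sum is T_n, meaningful for n \<ge> 1. For n \<ge> 1 and a < b all
   evaluation points lie in {a..b}, so the values of f outside {a..b} are irrelevant. *)

definition right_sum :: "(real \<Rightarrow> real) \<Rightarrow> real \<Rightarrow> real \<Rightarrow> nat \<Rightarrow> real"
  where "right_sum f a b n = (b - a) / real n * (\<Sum>i = 1..n. f (grid_point a b n i))"

definition left_sum :: "(real \<Rightarrow> real) \<Rightarrow> real \<Rightarrow> real \<Rightarrow> nat \<Rightarrow> real"
  where "left_sum f a b n = (b - a) / real n * (\<Sum>i = 0..<n. f (grid_point a b n i))"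

(* The strict counterpart of convex_on: distinct points, both weights positive. *)
definition strictly_convex_on :: "'a::real_vector set \<Rightarrow> ('a \<Rightarrow> real) \<Rightarrow> bool"
  where "strictly_convex_on A f \<longleftrightarrow> convex A \<and>
    (\<forall>x\<in>A. \<forall>y\<in>A. \<forall>u>0. \<forall>v>0. x \<noteq> y \<longrightarrow> u + v = 1 \<longrightarrow>
      f (u *\<^sub>R x + v *\<^sub>R y) < u * f x + v * f y)"

end

theory Submission
  imports Defs
begin

text \<open>With $B_n$ the sum of $f$ over the interior nodes, $S_n$ and $T_n$ are $\frac{b-a}{n}$ times
  $B_n + f(b)$ and $B_n + f(a)$. The four inequalities then reduce to two:
  $n B_n \le (n-1) B_{n+1}$ and $(n+1) B_{n+1} \le (n+2) B_n + f(a) + f(b)$.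
  Both follow by summing convexity over the interlacing nodes, since
  $x_i^{(n)} = \frac{n-i}{n} x_i^{(n+1)} + \frac{i}{n} x_{i+1}^{(n+1)}$ and
  $x_i^{(n+1)} = \frac{i}{n+1} x_{i-1}^{(n)} + \frac{n+1-i}{n+1} x_i^{(n)}$.\<close>

definition inner_sum :: "(real \<Rightarrow> real) \<Rightarrow> real \<Rightarrow> real \<Rightarrow> nat \<Rightarrow> real"
  where "inner_sum f a b n = (\<Sum>i = 1..<n. f (grid_point a b n i))"

text \<open>Taken as a difference rather than an inequality: its sign alone then separates the
  convex, strict, concave and equality cases. The same holds for
  \<open>coarsening_gap\<close>.\<close>

definition refinement_gap :: "(real \<Rightarrow> real) \<Rightarrow> real \<Rightarrow> real \<Rightarrow> nat \<Rightarrow> real"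
  where "refinement_gap f a b n =
    (real n - 1) * inner_sum f a b (n + 1) - real n * inner_sum f a b n"

definition coarsening_gap :: "(real \<Rightarrow> real) \<Rightarrow> real \<Rightarrow> real \<Rightarrow> nat \<Rightarrow> real"
  where "coarsening_gap f a b n =
    (real n + 2) * inner_sum f a b n + f a + f b - (real n + 1) * inner_sum f a b (n + 1)"

section \<open>Nodes of consecutive grids and their interlacing\<close>

lemma grid_point_0 [simp]: "grid_point a b n 0 = a"
  by (simp add: grid_point_def)

lemma grid_point_self [simp]: "n \<ge> 1 \<Longrightarrow> grid_point a b n n = b"
  by (simp add: grid_point_def)

lemma grid_point_in_interval:
  assumes "a < b" "n \<ge> 1" "i \<le> n"
  shows "grid_point a b n i \<in> {a..b}"
proof -
  have "real i * ((b - a) / real n) \<le> real n * ((b - a) / real n)"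
    using assms by (intro mult_right_mono) auto
  then show ?thesis
    using assms by (simp add: grid_point_def)
qed

lemma grid_point_neq_Suc:
  assumes "a < b" "n \<ge> 1"
  shows "grid_point a b n i \<noteq> grid_point a b n (Suc i)"
  using assms by (simp add: grid_point_def field_simps)

text \<open>The coarse node exceeds the fine node of the same index by
  \<open>i * (b - a) / (n * (n + 1))\<close>, which is the fraction \<open>i / n\<close> of a fine
  step.\<close>

lemma grid_point_coarse_eq:
  assumes "n \<ge> 1"
  shows "grid_point a b n i =
    (real n - real i) / real n * grid_point a b (n + 1) i
      + real i / real n * grid_point a b (n + 1) (Suc i)"
proof -
  have "(real n - real i) / real n * (a + real i * ((b - a) / (real n + 1)))
      + real i / real n * (a + (real i + 1) * ((b - a) / (real n + 1)))
      = a + real i * ((b - a) / real n)"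
    using assms by (simp add: divide_simps) algebra
  then show ?thesis
    by (simp add: grid_point_def add.commute)
qed

text \<open>The fine node \<open>Suc i\<close> exceeds the coarse node \<open>i\<close> by
  \<open>(n - i) * (b - a) / (n * (n + 1))\<close>, which is the fraction
  \<open>(n - i) / (n + 1)\<close> of a coarse step.\<close>

lemma grid_point_fine_eq:
  assumes "n \<ge> 1"
  shows "grid_point a b (n + 1) (Suc i) =
    (real i + 1) / (real n + 1) * grid_point a b n i
      + (real n - real i) / (real n + 1) * grid_point a b n (Suc i)"
proof -
  have "(real i + 1) / (real n + 1) * (a + real i * ((b - a) / real n))
      + (real n - real i) / (real n + 1) * (a + (real i + 1) * ((b - a) / real n))
      = a + (real i + 1) * ((b - a) / (real n + 1))"
    using assms by (simp add: divide_simps) algebra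
  then show ?thesis
    by (simp add: grid_point_def add.commute)
qed

section \<open>Sums over interior nodes and summation of the interlacing weights\<close>

lemma right_sum_eq_inner_sum:
  assumes "n \<ge> 1"
  shows "right_sum f a b n = (b - a) / real n * (inner_sum f a b n + f b)"
proof -
  have "{1..n} = insert n {1..<n}"
    using assms by auto
  then show ?thesis
    using assms by (simp add: right_sum_def inner_sum_def)
qed

lemma left_sum_eq_inner_sum:
  assumes "n \<ge> 1"
  shows "left_sum f a b n = (b - a) / real n * (inner_sum f a b n + f a)"
proof -
  have "{0..<n} = insert 0 {1..<n}"
    using assms by auto
  then show ?thesis
    by (simp add: left_sum_def inner_sum_def)
qed

text \<open>For \<open>1 \<le> j \<le> m\<close> the term \<open>y j\<close> collects
  \<open>(c - j) + (j - 1) = c - 1\<close>; the last term \<open>y (Suc m)\<close> collects only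
  \<open>m\<close>, hence the correction. The parameter \<open>c\<close> stays fixed while the
  induction moves \<open>m\<close>.\<close>

lemma sum_weighted_next:
  fixes y :: "nat \<Rightarrow> real"
  shows "(\<Sum>i = 1..m. (c - real i) * y i + real i * y (Suc i))
    = (c - 1) * (\<Sum>i = 1..Suc m. y i) + (real m + 1 - c) * y (Suc m)"
  by (induction m) (simp_all add: algebra_simps)

text \<open>For \<open>1 \<le> j < m\<close> the term \<open>x j\<close> collects
  \<open>(j + 1) + (c - j + 1) = c + 2\<close>. For \<open>m \<ge> 1\<close> the ends
  \<open>x 0\<close> and \<open>x m\<close> occur once each, with coefficients \<open>1\<close> and
  \<open>c - m + 1\<close>.\<close>

lemma sum_weighted_prev:
  fixes x :: "nat \<Rightarrow> real"
  shows "(\<Sum>i<m. (real i + 1) * x i + (c - real i) * x (Suc i))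
    = (c + 2) * (\<Sum>i = 1..m. x i) + x 0 - (real m + 1) * x m"
  by (induction m) (simp_all add: algebra_simps)

lemma refinement_gap_eq_sum:
  assumes "n \<ge> 1"
  shows "refinement_gap f a b n = (\<Sum>i = 1..<n.
    (real n - real i) * f (grid_point a b (n + 1) i)
      + real i * f (grid_point a b (n + 1) (Suc i)) - real n * f (grid_point a b n i))"
proof -
  obtain m where m: "n = Suc m"
    using assms by (cases n) auto
  show ?thesis
    \<comment> \<open>With \<open>c = n\<close> and \<open>m = n - 1\<close> the correction term
      vanishes, and the sum up to \<open>Suc m\<close> runs over exactly the interior nodes of the
      finer grid.\<close>
    using sum_weighted_next[of "real n" "\<lambda>i. f (grid_point a b (n + 1) i)" m]
    by (simp add: m refinement_gap_def inner_sum_def sum_subtractf sum_distrib_left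
        atLeastLessThanSuc_atLeastAtMost del: sum.cl_ivl_Suc)
qed

lemma coarsening_gap_eq_sum:
  assumes "n \<ge> 1"
  shows "coarsening_gap f a b n = (\<Sum>i<n.
    (real i + 1) * f (grid_point a b n i) + (real n - real i) * f (grid_point a b n (Suc i))
      - (real n + 1) * f (grid_point a b (n + 1) (Suc i)))"
proof -
  \<comment> \<open>The interior fine nodes \<open>1, ..., n\<close> are reindexed as
    \<open>Suc i\<close> with \<open>i < n\<close>, to match the pairs of neighbouring coarse
    nodes.\<close>
  have fine: "inner_sum f a b (n + 1) = (\<Sum>i<n. f (grid_point a b (n + 1) (Suc i)))"
    unfolding inner_sum_def
    by (simp add: sum.atLeast_Suc_lessThan_Suc_shift lessThan_atLeast0 del: sum.op_ivl_Suc)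
  have "{1..n} = insert n {1..<n}"
    using assms by auto
  then have coarse: "(\<Sum>i = 1..n. f (grid_point a b n i)) = inner_sum f a b n + f b"
    using assms by (simp add: inner_sum_def)
  show ?thesis
    \<comment> \<open>Here \<open>c\<close> and \<open>m\<close> both equal \<open>n\<close>, so
      \<open>f b\<close> gets the coefficient \<open>(n + 2) - (n + 1) = 1\<close>, the same as
      \<open>f a\<close>.\<close>
    unfolding sum_subtractf
      sum_weighted_prev[where c = "real n" and x = "\<lambda>i. f (grid_point a b n i)"] coarse
      coarsening_gap_def fine sum_distrib_left[symmetric]
    using assms by (simp add: algebra_simps)
qed

text \<open>Convexity with the denominator \<open>u + v\<close> cleared, so that it applies directly
  to the integer weights in the gap sums.\<close>

lemma scaled_convex_on:
  assumes "convex_on A f" "x \<in> A" "y \<in> A" "u \<ge> 0" "v \<ge> 0" "u + v > 0"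
    and "z = u / (u + v) * x + v / (u + v) * (y::real)"
  shows "(u + v) * f z \<le> u * f x + v * f y"
proof -
  have "u / (u + v) + v / (u + v) = 1"
    using assms(6) by (simp flip: add_divide_distrib)
  then have "f z \<le> u / (u + v) * f x + v / (u + v) * f y"
    using assms unfolding convex_on_def by (simp del: times_divide_eq_left)
  then show ?thesis
    using assms(6) by (simp add: pos_le_divide_eq mult.commute flip: add_divide_distrib)
qed

lemma scaled_strictly_convex_on:
  assumes "strictly_convex_on A f" "x \<in> A" "y \<in> A" "x \<noteq> y" "u > 0" "v > 0"
    and "z = u / (u + v) * x + v / (u + v) * (y::real)"
  shows "(u + v) * f z < u * f x + v * f y"
proof -
  have "u / (u + v) + v / (u + v) = 1"
    using assms(5,6) by (simp flip: add_divide_distrib)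
  then have "f z < u / (u + v) * f x + v / (u + v) * f y"
    using assms unfolding strictly_convex_on_def by (simp del: times_divide_eq_left)
  then show ?thesis
    using assms(5,6) by (simp add: pos_less_divide_eq mult.commute flip: add_divide_distrib)
qed

section \<open>Signs of the two gaps\<close>

lemma refinement_gap_nonneg:
  assumes "convex_on {a..b} f" "a < b" "n \<ge> 1"
  shows "refinement_gap f a b n \<ge> 0"
  unfolding refinement_gap_eq_sum[OF assms(3)]
proof (rule sum_nonneg)
  \<comment> \<open>The weights \<open>n - i\<close> and \<open>i\<close> add up to
    \<open>n\<close>, the coefficient of the coarse value, so each summand is one instance of scaled
    convexity.\<close>
  fix i assume "i \<in> {1..<n}"
  then show "0 \<le> (real n - real i) * f (grid_point a b (n + 1) i)
      + real i * f (grid_point a b (n + 1) (Suc i)) - real n * f (grid_point a b n i)"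
    using scaled_convex_on[OF assms(1), of "grid_point a b (n + 1) i"
        "grid_point a b (n + 1) (Suc i)" "real n - real i" "real i" "grid_point a b n i"]
      grid_point_in_interval[OF assms(2), of "n + 1"] grid_point_coarse_eq[OF assms(3), of a b i]
    by simp
qed

lemma coarsening_gap_nonneg:
  assumes "convex_on {a..b} f" "a < b" "n \<ge> 1"
  shows "coarsening_gap f a b n \<ge> 0"
  unfolding coarsening_gap_eq_sum[OF assms(3)]
proof (rule sum_nonneg)
  \<comment> \<open>The weights \<open>i + 1\<close> and \<open>n - i\<close> add up to
    \<open>n + 1\<close>, the coefficient of the fine value.\<close>
  fix i assume "i \<in> {..<n}"
  then show "0 \<le> (real i + 1) * f (grid_point a b n i)
      + (real n - real i) * f (grid_point a b n (Suc i))
      - (real n + 1) * f (grid_point a b (n + 1) (Suc i))"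
    using scaled_convex_on[OF assms(1), of "grid_point a b n i" "grid_point a b n (Suc i)"
        "real i + 1" "real n - real i" "grid_point a b (n + 1) (Suc i)"]
      grid_point_in_interval[OF assms(2,3)] grid_point_fine_eq[OF assms(3), of a b i]
    by (simp add: add.commute)
qed

text \<open>For \<open>1 \<le> i < n\<close> both weights are positive and the two fine nodes
  differ, so every summand is positive; \<open>n \<ge> 2\<close> makes the index set
  nonempty.\<close>

lemma refinement_gap_pos:
  assumes "strictly_convex_on {a..b} f" "a < b" "n \<ge> 2"
  shows "refinement_gap f a b n > 0"
proof -
  have n: "n \<ge> 1"
    using assms(3) by simp
  show ?thesis
    unfolding refinement_gap_eq_sum[OF n]
  proof (rule sum_pos)
    fix i assume "i \<in> {1..<n}"
    then show "0 < (real n - real i) * f (grid_point a b (n + 1) i)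
        + real i * f (grid_point a b (n + 1) (Suc i)) - real n * f (grid_point a b n i)"
      using scaled_strictly_convex_on[OF assms(1), of "grid_point a b (n + 1) i"
          "grid_point a b (n + 1) (Suc i)" "real n - real i" "real i" "grid_point a b n i"]
        grid_point_in_interval[OF assms(2), of "n + 1"] grid_point_coarse_eq[OF n, of a b i]
        grid_point_neq_Suc[OF assms(2), of "n + 1" i]
      by simp
  qed (use assms(3) in auto)
qed

lemma coarsening_gap_pos:
  assumes "strictly_convex_on {a..b} f" "a < b" "n \<ge> 1"
  shows "coarsening_gap f a b n > 0"
  unfolding coarsening_gap_eq_sum[OF assms(3)]
proof (rule sum_pos)
  fix i assume "i \<in> {..<n}"
  then show "0 < (real i + 1) * f (grid_point a b n i)
      + (real n - real i) * f (grid_point a b n (Suc i))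
      - (real n + 1) * f (grid_point a b (n + 1) (Suc i))"
    using scaled_strictly_convex_on[OF assms(1), of "grid_point a b n i" "grid_point a b n (Suc i)"
        "real i + 1" "real n - real i" "grid_point a b (n + 1) (Suc i)"]
      grid_point_in_interval[OF assms(2,3)] grid_point_fine_eq[OF assms(3), of a b i]
      grid_point_neq_Suc[OF assms(2,3), of i]
    by (simp add: add.commute)
qed (use assms(3) in \<open>auto simp: lessThan_empty_iff\<close>)

section \<open>Negation of \<open>f\<close>, the case \<open>n = 1\<close>, and exact slack of the
  four inequalities\<close>

lemma inner_sum_uminus: "inner_sum (\<lambda>x. - f x) a b n = - inner_sum f a b n"
  by (simp add: inner_sum_def sum_negf)

lemma refinement_gap_uminus: "refinement_gap (\<lambda>x. - f x) a b n = - refinement_gap f a b n"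
  by (simp add: refinement_gap_def inner_sum_uminus)

lemma coarsening_gap_uminus: "coarsening_gap (\<lambda>x. - f x) a b n = - coarsening_gap f a b n"
  by (simp add: coarsening_gap_def inner_sum_uminus)

text \<open>Both terms vanish: the factor \<open>real n - 1\<close> is zero and the coarse grid has
  no interior node. This is the source of the two equalities at \<open>n = 1\<close>.\<close>

lemma refinement_gap_1 [simp]: "refinement_gap f a b 1 = 0"
  by (simp add: refinement_gap_def inner_sum_def)

text \<open>Since \<open>1 + 1 / (n * (n + 2)) = (n + 1)^2 / (n * (n + 2))\<close>, collecting the
  \<open>S_{n+1}\<close> terms cancels its denominator \<open>n + 1\<close>; \<open>f b\<close> is
  left with coefficient \<open>(n + 2) - (n + 1) = 1\<close>.\<close>

lemma right_sum_lower_gap: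
  assumes "n \<ge> 1"
  shows "right_sum f a b n - right_sum f a b (n + 1) =
    1 / (real n * (real n + 2)) * (right_sum f a b (n + 1) - (b - a) * f a)
      + (b - a) / (real n * (real n + 2)) * coarsening_gap f a b n"
proof -
  have "real n \<noteq> 0" "real n + 1 \<noteq> 0" "real n + 2 \<noteq> 0"
    using assms by linarith+
  then show ?thesis
    using assms
    by (simp add: right_sum_eq_inner_sum coarsening_gap_def divide_simps add.commute) algebra
qed

text \<open>Here \<open>1 - 1 / n^2 = (n - 1) * (n + 1) / n^2\<close> cancels the denominator of
  \<open>S_{n+1}\<close>, and \<open>f b\<close> drops out because
  \<open>(n - 1) - n + 1 = 0\<close>.\<close>

lemma right_sum_upper_gap:
  assumes "n \<ge> 1"
  shows "1 / (real n)\<^sup>2 * ((b - a) * f b - right_sum f a b (n + 1)) =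
    right_sum f a b n - right_sum f a b (n + 1)
      + (b - a) / (real n)\<^sup>2 * refinement_gap f a b n"
proof -
  have "real n \<noteq> 0" "real n + 1 \<noteq> 0"
    using assms by linarith+
  then show ?thesis
    using assms
    by (simp add: right_sum_eq_inner_sum refinement_gap_def divide_simps add.commute) algebra
qed

text \<open>The same cancellation as for the upper bound on the right sums, with \<open>f a\<close>
  dropping out in place of \<open>f b\<close>.\<close>

lemma left_sum_lower_gap:
  assumes "n \<ge> 1"
  shows "left_sum f a b (n + 1) - left_sum f a b n =
    1 / (real n)\<^sup>2 * (left_sum f a b (n + 1) - (b - a) * f a)
      + (b - a) / (real n)\<^sup>2 * refinement_gap f a b n"
proof -
  have "real n \<noteq> 0" "real n + 1 \<noteq> 0"
    using assms by linarith+
  then show ?thesis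
    using assms
    by (simp add: left_sum_eq_inner_sum refinement_gap_def divide_simps add.commute) algebra
qed

lemma left_sum_upper_gap:
  assumes "n \<ge> 1"
  shows "1 / (real n * (real n + 2)) * ((b - a) * f b - left_sum f a b (n + 1)) =
    left_sum f a b (n + 1) - left_sum f a b n
      + (b - a) / (real n * (real n + 2)) * coarsening_gap f a b n"
proof -
  have "real n \<noteq> 0" "real n + 1 \<noteq> 0" "real n + 2 \<noteq> 0"
    using assms by linarith+
  then show ?thesis
    using assms
    by (simp add: left_sum_eq_inner_sum coarsening_gap_def divide_simps add.commute) algebra
qed

theorem corollary2p6:
  fixes f :: "real \<Rightarrow> real" and a b :: real
  assumes "a < b"
  shows "(convex_on {a..b} f \<longrightarrow>
     (\<forall>n\<ge>(1::nat).
       1 / (real n * (real n + 2)) * (right_sum f a b (n + 1) - (b - a) * f a)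
         \<le> right_sum f a b n - right_sum f a b (n + 1) \<and>
       right_sum f a b n - right_sum f a b (n + 1)
         \<le> 1 / (real n)\<^sup>2 * ((b - a) * f b - right_sum f a b (n + 1)) \<and>
       1 / (real n)\<^sup>2 * (left_sum f a b (n + 1) - (b - a) * f a)
         \<le> left_sum f a b (n + 1) - left_sum f a b n \<and>
       left_sum f a b (n + 1) - left_sum f a b n
         \<le> 1 / (real n * (real n + 2)) * ((b - a) * f b - left_sum f a b (n + 1)))) \<and>
   (right_sum f a b 1 - right_sum f a b (1 + 1)
         = 1 / (real 1)\<^sup>2 * ((b - a) * f b - right_sum f a b (1 + 1)) \<and>
       1 / (real 1)\<^sup>2 * (left_sum f a b (1 + 1) - (b - a) * f a)
         = left_sum f a b (1 + 1) - left_sum f a b 1) \<and>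
   (strictly_convex_on {a..b} f \<longrightarrow>
     (\<forall>n\<ge>(1::nat).
       1 / (real n * (real n + 2)) * (right_sum f a b (n + 1) - (b - a) * f a)
         < right_sum f a b n - right_sum f a b (n + 1) \<and>
       left_sum f a b (n + 1) - left_sum f a b n
         < 1 / (real n * (real n + 2)) * ((b - a) * f b - left_sum f a b (n + 1))) \<and>
     (\<forall>n\<ge>(2::nat).
       right_sum f a b n - right_sum f a b (n + 1)
         < 1 / (real n)\<^sup>2 * ((b - a) * f b - right_sum f a b (n + 1)) \<and>
       1 / (real n)\<^sup>2 * (left_sum f a b (n + 1) - (b - a) * f a)
         < left_sum f a b (n + 1) - left_sum f a b n)) \<and>
   (concave_on {a..b} f \<longrightarrow>
     (\<forall>n\<ge>(1::nat).
       1 / (real n * (real n + 2)) * (right_sum f a b (n + 1) - (b - a) * f a)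
         \<ge> right_sum f a b n - right_sum f a b (n + 1) \<and>
       right_sum f a b n - right_sum f a b (n + 1)
         \<ge> 1 / (real n)\<^sup>2 * ((b - a) * f b - right_sum f a b (n + 1)) \<and>
       1 / (real n)\<^sup>2 * (left_sum f a b (n + 1) - (b - a) * f a)
         \<ge> left_sum f a b (n + 1) - left_sum f a b n \<and>
       left_sum f a b (n + 1) - left_sum f a b n
         \<ge> 1 / (real n * (real n + 2)) * ((b - a) * f b - left_sum f a b (n + 1))))"
proof -
  have pos: "(b - a) / (real n * (real n + 2)) > 0" "(b - a) / (real n)\<^sup>2 > 0"
    if "n \<ge> 1" for n
    using that assms by auto
  note gap_eqs = right_sum_lower_gap[of _ f a b] right_sum_upper_gap[of _ b a f]
    left_sum_lower_gap[of _ f a b] left_sum_upper_gap[of _ b a f]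
  have convex: "0 \<le> (b - a) / (real n * (real n + 2)) * coarsening_gap f a b n"
    "0 \<le> (b - a) / (real n)\<^sup>2 * refinement_gap f a b n"
    if "convex_on {a..b} f" "n \<ge> 1" for n
    using pos[OF that(2)] coarsening_gap_nonneg[OF that(1) assms that(2)]
      refinement_gap_nonneg[OF that(1) assms that(2)]
    by (meson less_imp_le mult_nonneg_nonneg)+
  have concave: "(b - a) / (real n * (real n + 2)) * coarsening_gap f a b n \<le> 0"
    "(b - a) / (real n)\<^sup>2 * refinement_gap f a b n \<le> 0"
    if "concave_on {a..b} f" "n \<ge> 1" for n
  proof -
    \<comment> \<open>Both gaps are odd in \<open>f\<close>, so their signs for the convex function
      \<open>-f\<close> give the reversed signs for \<open>f\<close>.\<close>
    have "convex_on {a..b} (\<lambda>x. - f x)"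
      using that(1) by (simp add: concave_on_def)
    then have "coarsening_gap f a b n \<le> 0" "refinement_gap f a b n \<le> 0"
      using coarsening_gap_nonneg[OF _ assms that(2)] refinement_gap_nonneg[OF _ assms that(2)]
      by (fastforce simp: coarsening_gap_uminus refinement_gap_uminus)+
    then show "(b - a) / (real n * (real n + 2)) * coarsening_gap f a b n \<le> 0"
      "(b - a) / (real n)\<^sup>2 * refinement_gap f a b n \<le> 0"
      using pos[OF that(2)] by (meson less_imp_le mult_nonneg_nonpos)+
  qed
  have strict_coarsening: "0 < (b - a) / (real n * (real n + 2)) * coarsening_gap f a b n"
    if "strictly_convex_on {a..b} f" "n \<ge> 1" for n
    using pos(1)[OF that(2)] coarsening_gap_pos[OF that(1) assms that(2)]
    by (rule mult_pos_pos)
  have strict_refinement: "0 < (b - a) / (real n)\<^sup>2 * refinement_gap f a b n"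
    if "strictly_convex_on {a..b} f" "n \<ge> 2" for n
    using pos(2)[of n] that(2) refinement_gap_pos[OF that(1) assms that(2)]
    by (intro mult_pos_pos) auto
  show ?thesis
  proof (intro conjI impI allI)
    show "right_sum f a b 1 - right_sum f a b (1 + 1)
        = 1 / (real 1)\<^sup>2 * ((b - a) * f b - right_sum f a b (1 + 1))"
      unfolding right_sum_upper_gap[OF order_refl] refinement_gap_1 by simp
    show "1 / (real 1)\<^sup>2 * (left_sum f a b (1 + 1) - (b - a) * f a)
        = left_sum f a b (1 + 1) - left_sum f a b 1"
      unfolding left_sum_lower_gap[OF order_refl] refinement_gap_1 by simp
  \<comment> \<open>By the four identities each remaining inequality is the sign of a correction
    term; the two extra rules supply \<open>n \<ge> 1\<close> from \<open>n \<ge> 2\<close>.\<close>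
  qed (use gap_eqs convex concave strict_coarsening strict_refinement in
      \<open>smt (verit) one_le_numeral order_trans\<close>)+
qed

end
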